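(* Let $0<\lambda<1$ and $0<q\le 1$, and let $T_1^q,T_2^q,\dots$ be independent identically distributed random variables with values in $\{1,2,3,\dots\}$ such that $P(T_i^q>t)=F_{q,-\lambda}(t)$ for all $t=1,2,\dots$. Put $S_0^q=0$, $S_n^q=T_1^q+\dots+T_n^q$ for $n\ge 1$, and define the discrete fractional Poisson process by $N^q(t)=\max\{n\ge 0: S_n^q\le t\}$. Then for every $n=0,1,2,\dots$ and every integer $t\ge n$, $$P(N^q(t)=n)=\lambda^n\sum_{m=0}^\infty\binom{n+m}{n}(-\lambda)^m\Big[\hat h_{q(n+m)}(t-n+1)+\lambda\,\hat h_{q(n+m+1)-1}(t-n+1)\Big].$$
   Context: For $x\in\mathbb{R}\setminus\{0,-1,-2,\dots\}$ and $\alpha\in\mathbb{R}\setminus\{-1,-2,\dots\}$ with $x+\alpha\notin\{0,-1,-2,\dots\}$, the generalized binomial coefficient is $$\hat h_\alpha(x)=\frac{\Gamma(x+\alpha)}{\Gamma(\alpha+1)\,\Gamma(x)}.$$ For real $q>0$ the discrete Mittag-Leffler function is $$F_{q,\lambda}(t)=\sum_{m=0}^\infty \hat h_{qm}(t)\,\lambda^m ,$$ so that $F_{q,-\lambda}(t)=\sum_{m=0}^\infty \hat h_{qm}(t)\,(-\lambda)^m$. *)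

theory Defs
  imports "HOL-Probability.Probability"
begin

text \<open>The generalized binomial coefficient. It is only meaningful away from the poles of the
  Gamma functions involved (the library sets Gamma to 0 at its poles).\<close>

definition hhat :: "real \<Rightarrow> real \<Rightarrow> real" where
  "hhat \<alpha> x = Gamma (x + \<alpha>) / (Gamma (\<alpha> + 1) * Gamma x)"

definition discrete_ML :: "real \<Rightarrow> real \<Rightarrow> real \<Rightarrow> real" where
  "discrete_ML q c t = (\<Sum>m. hhat (q * real m) t * c ^ m)"

definition arrival_time :: "(nat \<Rightarrow> 'a \<Rightarrow> nat) \<Rightarrow> nat \<Rightarrow> 'a \<Rightarrow> nat" where
  "arrival_time T n \<omega> = (\<Sum>i = 1..n. T i \<omega>)"

text \<open>If all waiting times are at least 1, the \<open>n\<close>-th arrival time is at least \<open>n\<close>, so the maximum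
  below is over a finite set, which contains 0.\<close>

definition counting_process :: "(nat \<Rightarrow> 'a \<Rightarrow> nat) \<Rightarrow> nat \<Rightarrow> 'a \<Rightarrow> nat" where
  "counting_process T t \<omega> = Max {n. arrival_time T n \<omega> \<le> t}"

end

theory Submission
  imports Defs "HOL-Computational_Algebra.Formal_Power_Series"
begin

text \<open>Since \<open>hhat a (k + 1)\<close> is the coefficient of \<open>X^k\<close> in \<open>(1 - X) powr (-(a + 1))\<close>, the tail
  condition says that each waiting time has the probability generating function
  \<open>p = lam X / ((1 - X) powr q + lam)\<close>. By independence, the generating function in \<open>t\<close> of
  \<open>P(N(t) = n) = P(S\<^sub>n \<le> t) - P(S\<^sub>n\<^sub>+\<^sub>1 \<le> t)\<close> is
  \<open>p^n (1 - p) / (1 - X) = lam^n X^n ((1 - X) powr (q - 1) + lam) / ((1 - X) powr q + lam)^(n + 1)\<close>,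
  and the negative binomial expansion in powers of \<open>lam (1 - X) powr (-q)\<close> gives the claim. All
  identities are between formal power series in \<open>X\<close>; the sums over powers of \<open>lam\<close> are taken
  coefficientwise, where the terms are polynomials in \<open>m\<close> times \<open>(-lam)^m\<close>.\<close>

section \<open>Power series with polynomially growing weights\<close>

lemma summable_affine_mult_power:
  fixes w :: "nat \<Rightarrow> real"
  assumes "\<And>x. \<bar>x\<bar> < 1 \<Longrightarrow> summable (\<lambda>m. w m * x ^ m)" and "\<bar>x\<bar> < 1"
  shows "summable (\<lambda>m. w m * (a * real m + b) * x ^ m)"
proof -
  have "summable (\<lambda>m. diffs w m * x ^ m)"
    using termdiff_converges[of x 1 w] assms by simp
  then have "summable (\<lambda>m. x * (diffs w m * x ^ m))"
    by (rule summable_mult)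
  then have "summable (\<lambda>m. real (Suc m) * w (Suc m) * x ^ Suc m)"
    by (simp add: diffs_def algebra_simps)
  then have "summable (\<lambda>m. real m * w m * x ^ m)"
    by (subst (asm) summable_Suc_iff)
  then have "summable (\<lambda>m. a * (real m * w m * x ^ m) + b * (w m * x ^ m))"
    using assms by (intro summable_add summable_mult)
  then show ?thesis
    by (simp add: algebra_simps)
qed

text \<open>The rising factorial is a product of \<open>k\<close> factors affine in
  \<open>m\<close>. Each costs one termwise differentiation, which preserves convergence only on the
  open disc, so convergence is assumed on all of it and \<open>x\<close> stays arbitrary in the
  induction.\<close>

lemma summable_pochhammer_mult_power:
  fixes w :: "nat \<Rightarrow> real"
  assumes "\<And>x. \<bar>x\<bar> < 1 \<Longrightarrow> summable (\<lambda>m. w m * x ^ m)" and "\<bar>x\<bar> < 1"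
  shows "summable (\<lambda>m. w m * pochhammer (a * real m + b) k * x ^ m)"
  using assms(2)
proof (induction k arbitrary: x)
  case 0
  then show ?case using assms by simp
next
  case (Suc k)
  have "summable (\<lambda>m. w m * pochhammer (a * real m + b) k * (a * real m + (b + real k)) * x ^ m)"
    using Suc by (intro summable_affine_mult_power)
  then show ?case
    by (simp add: pochhammer_Suc algebra_simps)
qed

section \<open>Binomial series with real exponents\<close>

text \<open>The binomial expansion of \<open>(1 - X) powr (-a)\<close>.\<close>

definition fps_rising :: "real \<Rightarrow> real fps" where
  "fps_rising a = Abs_fps (\<lambda>k. pochhammer a k / fact k)"

lemma fps_rising_0 [simp]: "fps_rising 0 = 1"
  by (rule fps_ext) (auto simp: fps_rising_def pochhammer_0_left)

text \<open>Multiplying by this geometric series replaces coefficients by their partial sums; this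
  is how distribution functions enter below.\<close>

lemma fps_rising_1: "fps_rising 1 = Abs_fps (\<lambda>_. 1)"
  by (rule fps_ext) (simp add: fps_rising_def flip: pochhammer_fact)

text \<open>Coefficientwise this is the Vandermonde identity for rising factorials.\<close>

lemma fps_rising_add: "fps_rising (a + b) = fps_rising a * fps_rising b"
proof (rule fps_ext)
  fix k
  have "pochhammer (a + b) k / fact k =
      (\<Sum>i\<le>k. of_nat (k choose i) * pochhammer a i * pochhammer b (k - i) / fact k)"
    by (simp add: pochhammer_binomial_sum sum_divide_distrib)
  also have "\<dots> = (\<Sum>i\<le>k. (pochhammer a i / fact i) * (pochhammer b (k - i) / fact (k - i)))"
    by (intro sum.cong refl) (simp add: binomial_fact)
  finally show "fps_nth (fps_rising (a + b)) k = fps_nth (fps_rising a * fps_rising b) k"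
    by (simp add: fps_rising_def fps_mult_nth atMost_atLeast0)
qed

lemma one_minus_X_mult_fps_rising_1: "(1 - fps_X) * fps_rising 1 = 1"
proof (rule fps_ext)
  fix k :: nat
  show "fps_nth ((1 - fps_X) * fps_rising 1) k = fps_nth 1 k"
    by (cases k) (simp_all add: fps_rising_1 left_diff_distrib)
qed

lemma fps_rising_of_nat_mult: "fps_rising (real n * a) = fps_rising a ^ n"
  by (induction n) (simp_all add: distrib_right fps_rising_add)

text \<open>The quotient Gamma(a + 1 + k) / Gamma(a + 1) is a rising factorial. The bound a > -1
  avoids the poles yet admits the possibly negative index \<open>q * real (n + m + 1) - 1\<close> of
  the theorem.\<close>

lemma hhat_Suc:
  assumes "0 < a + 1"
  shows "hhat a (real k + 1) = fps_nth (fps_rising (a + 1)) k"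
proof -
  have "a + 1 \<notin> \<int>\<^sub>\<le>\<^sub>0"
    using assms by (auto elim!: nonpos_Ints_cases)
  moreover have "Gamma (real k + 1) = fact k"
    using Gamma_fact[of k, where 'a = real] by (simp add: add.commute)
  ultimately show ?thesis
    by (simp add: hhat_def fps_rising_def pochhammer_Gamma add_ac)
qed

section \<open>Negative binomial series and the generating-function identity\<close>

text \<open>The series \<open>\<Sum>m. (n + m choose n) (-lam)^m (1 - X) powr (-(q m + c))\<close>. Its partial sums do
  not converge as formal power series, only coefficientwise in the reals.\<close>

definition mittag_fps :: "real \<Rightarrow> real \<Rightarrow> nat \<Rightarrow> real \<Rightarrow> real fps" where
  "mittag_fps q lam n c = Abs_fps (\<lambda>k. \<Sum>m. real ((n + m) choose n) * (- lam) ^ m *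
     fps_nth (fps_rising (q * real m + c)) k)"

text \<open>For fixed \<open>n\<close> and \<open>k\<close> both the binomial coefficient and the
  series coefficient are polynomials in \<open>m\<close>, so the geometric factor dominates.\<close>

lemma summable_mittag_fps:
  assumes "\<bar>lam\<bar> < 1"
  shows "summable (\<lambda>m. real ((n + m) choose n) * (- lam) ^ m * fps_nth (fps_rising (q * real m + c)) k)"
proof -
  have binom: "real ((n + m) choose n) = pochhammer (1 * real m + 1) n / fact n" for m
    by (simp add: binomial_gbinomial gbinomial_pochhammer' add_ac)
  have "summable (\<lambda>m. real ((n + m) choose n) * x ^ m)" if "\<bar>x\<bar> < 1" for x :: real
  proof -
    have "summable (\<lambda>m. 1 * pochhammer (1 * real m + 1) n * x ^ m)"
      using that by (intro summable_pochhammer_mult_power) auto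
    then have "summable (\<lambda>m. 1 * pochhammer (1 * real m + 1) n * x ^ m / fact n)"
      by (rule summable_divide)
    then show ?thesis
      unfolding binom by (simp add: mult_ac)
  qed
  then have "summable (\<lambda>m. real ((n + m) choose n) * pochhammer (q * real m + c) k * (- lam) ^ m)"
    using assms by (intro summable_pochhammer_mult_power) auto
  then have "summable (\<lambda>m. real ((n + m) choose n) * pochhammer (q * real m + c) k * (- lam) ^ m / fact k)"
    by (rule summable_divide)
  then show ?thesis
    by (simp add: fps_rising_def mult_ac)
qed

text \<open>The exponent law holds in each term. A coefficient of a product is a finite sum, which
  may be exchanged with the convergent sum over \<open>m\<close>.\<close>

lemma mittag_fps_add:
  assumes "\<bar>lam\<bar> < 1"
  shows "mittag_fps q lam n (c + d) = fps_rising d * mittag_fps q lam n c"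
proof (rule fps_ext)
  fix k
  let ?w = "\<lambda>m. real ((n + m) choose n) * (- lam) ^ m"
  let ?B = "\<lambda>m. fps_rising (q * real m + c)"
  have "?w m * fps_nth (fps_rising (q * real m + (c + d))) k =
      (\<Sum>i=0..k. fps_nth (fps_rising d) i * (?w m * fps_nth (?B m) (k - i)))" for m
  proof -
    have "fps_rising (q * real m + (c + d)) = fps_rising d * ?B m"
      by (simp flip: fps_rising_add add: add_ac)
    then show ?thesis
      by (simp add: fps_mult_nth sum_distrib_left mult_ac)
  qed
  then show "fps_nth (mittag_fps q lam n (c + d)) k = fps_nth (fps_rising d * mittag_fps q lam n c) k"
    using summable_mittag_fps[OF assms]
    by (simp add: mittag_fps_def fps_mult_nth suminf_sum summable_mult suminf_mult)
qed

text \<open>This is the geometric series in -L with L = \<open>fps_const lam * fps_rising q\<close>.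
  Since L has constant term \<open>lam\<close>, which need not vanish, the telescoping is done on
  real coefficients.\<close>

lemma mittag_fps_0_inverse:
  assumes "\<bar>lam\<bar> < 1"
  shows "mittag_fps q lam 0 0 * (1 + fps_const lam * fps_rising q) = 1"
proof -
  \<comment> \<open>The form \<open>0 + q\<close> lets \<open>mittag_fps_add\<close> split off the
    factor \<open>fps_rising q\<close> afterwards.\<close>
  have "mittag_fps q lam 0 0 + fps_const lam * mittag_fps q lam 0 (0 + q) = 1"
  proof (rule fps_ext)
    fix k
    define f where "f m = (- lam) ^ m * fps_nth (fps_rising (q * real m)) k" for m
    have f: "summable f"
      using summable_mittag_fps[OF assms, of 0 q 0 k] by (simp add: f_def[abs_def])
    have "lam * (\<Sum>m. (- lam) ^ m * fps_nth (fps_rising (q * real m + q)) k) =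
        (\<Sum>m. lam * ((- lam) ^ m * fps_nth (fps_rising (q * real m + q)) k))"
      using summable_mittag_fps[OF assms, of 0 q q k] by (simp add: suminf_mult)
    also have "\<dots> = (\<Sum>m. - f (Suc m))"
      by (simp add: f_def algebra_simps)
    also have "\<dots> = - (\<Sum>m. f (Suc m))"
      using f by (intro suminf_minus) (simp add: summable_Suc_iff)
    also have "\<dots> = f 0 - suminf f"
      using suminf_split_head[OF f] by simp
    finally have "suminf f + lam * (\<Sum>m. (- lam) ^ m * fps_nth (fps_rising (q * real m + q)) k) = f 0"
      by simp
    then show "fps_nth (mittag_fps q lam 0 0 + fps_const lam * mittag_fps q lam 0 (0 + q)) k = fps_nth 1 k"
      by (simp add: mittag_fps_def f_def[abs_def])
  qed
  then show ?thesis
    using assms by (simp only: mittag_fps_add) (simp add: algebra_simps)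
qed

text \<open>Multiplication by L shifts the summation index by one and flips the sign, so Pascal's
  rule lowers \<open>Suc n\<close> to \<open>n\<close>.\<close>

lemma mittag_fps_Suc_mult:
  assumes "\<bar>lam\<bar> < 1"
  shows "mittag_fps q lam (Suc n) 0 * (1 + fps_const lam * fps_rising q) = mittag_fps q lam n 0"
proof -
  have "mittag_fps q lam (Suc n) 0 + fps_const lam * mittag_fps q lam (Suc n) (0 + q) = mittag_fps q lam n 0"
  proof (rule fps_ext)
    fix k
    define B where "B m = (- lam) ^ m * fps_nth (fps_rising (q * real m)) k" for m
    define f where "f m = real ((Suc n + m) choose Suc n) * B m" for m
    define g where "g m = real ((n + m) choose n) * B m" for m
    define h where "h m = real ((Suc n + m) choose Suc n) * (- lam) ^ m * fps_nth (fps_rising (q * real m + q)) k" for m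
    have f: "summable f"
      using summable_mittag_fps[OF assms, of "Suc n" q 0 k] by (simp add: f_def[abs_def] B_def mult_ac)
    have g: "summable g"
      using summable_mittag_fps[OF assms, of n q 0 k] by (simp add: g_def[abs_def] B_def mult_ac)
    have h: "summable h"
      using summable_mittag_fps[OF assms, of "Suc n" q q k] by (simp add: h_def[abs_def])
    have pascal: "f (Suc m) + lam * h m = g (Suc m)" for m
      by (simp add: f_def g_def h_def B_def algebra_simps)
    have "suminf f + lam * suminf h = f 0 + ((\<Sum>m. f (Suc m)) + (\<Sum>m. lam * h m))"
      using suminf_split_head[OF f] h by (simp add: suminf_mult)
    also have "\<dots> = g 0 + (\<Sum>m. g (Suc m))"
      using f h by (subst suminf_add) (simp_all add: summable_Suc_iff summable_mult pascal, simp add: f_def g_def)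
    also have "\<dots> = suminf g"
      using suminf_split_head[OF g] by simp
    finally have "suminf f + lam * suminf h = suminf g" .
    then show "fps_nth (mittag_fps q lam (Suc n) 0 + fps_const lam * mittag_fps q lam (Suc n) (0 + q)) k =
        fps_nth (mittag_fps q lam n 0) k"
      by (simp add: mittag_fps_def f_def[abs_def] g_def[abs_def] h_def[abs_def] B_def mult.assoc)
  qed
  then show ?thesis
    using assms by (simp only: mittag_fps_add) (simp add: algebra_simps)
qed

lemma mittag_fps_eq_power:
  assumes "\<bar>lam\<bar> < 1"
  shows "mittag_fps q lam n 0 = mittag_fps q lam 0 0 ^ Suc n"
proof (induction n)
  case (Suc n)
  have "mittag_fps q lam (Suc n) 0 =
      mittag_fps q lam (Suc n) 0 * (1 + fps_const lam * fps_rising q) * mittag_fps q lam 0 0"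
    using mittag_fps_0_inverse[OF assms] by (simp add: mult_ac)
  also have "\<dots> = mittag_fps q lam n 0 * mittag_fps q lam 0 0"
    by (simp only: mittag_fps_Suc_mult[OF assms])
  finally show ?case
    using Suc by (simp add: mult_ac)
qed simp

text \<open>With S = 1 / (1 + L) one has p = X L S, so no negative powers of 1 - X are inverted. On
  the right, L^n supplies \<open>lam ^ n\<close> and the exponent \<open>q * real n\<close>; the
  further \<open>1\<close> and \<open>q\<close> come from the two summands of 1 / (1 - X) +
  L.\<close>

lemma renewal_fps_identity:
  fixes q lam :: real and n :: nat
  defines "p \<equiv> fps_X * (1 - mittag_fps q lam 0 0)"
  assumes "\<bar>lam\<bar> < 1"
  shows "p ^ n * (1 - p) * fps_rising 1 = fps_X ^ n * (fps_const (lam ^ n) *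
    (mittag_fps q lam n (q * real n + 1) + fps_const lam * mittag_fps q lam n (q * real n + q)))"
proof -
  define S where "S = mittag_fps q lam 0 0"
  define L where "L = fps_const lam * fps_rising q"
  have inv: "S * (1 + L) = 1"
    using mittag_fps_0_inverse[OF assms(2)] by (simp add: S_def L_def)
  then have "1 - S = L * S"
    by (simp add: algebra_simps)
  then have p: "p = fps_X * L * S"
    by (simp add: p_def S_def mult_ac)
  have "1 - p = S * (1 + L) - fps_X * L * S"
    by (simp add: inv p)
  also have "\<dots> = S * (1 + (1 - fps_X) * L)"
    by (simp add: algebra_simps)
  finally have "(1 - p) * fps_rising 1 = S * (1 + (1 - fps_X) * L) * fps_rising 1"
    by (rule arg_cong)
  also have "\<dots> = S * (fps_rising 1 + ((1 - fps_X) * fps_rising 1) * L)"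
    by (simp add: algebra_simps)
  finally have "(1 - p) * fps_rising 1 = S * (fps_rising 1 + ((1 - fps_X) * fps_rising 1) * L)" .
  \<comment> \<open>The factor 1 - X in front of L cancels against the geometric series.\<close>
  then have compl: "(1 - p) * fps_rising 1 = S * (fps_rising 1 + L)"
    by (simp only: one_minus_X_mult_fps_rising_1) simp
  have shift: "mittag_fps q lam n (q * real n + c) = fps_rising q ^ n * fps_rising c * S ^ Suc n" for c
    using mittag_fps_add[OF assms(2), of q n 0 "q * real n + c"]
    by (simp add: fps_rising_add mittag_fps_eq_power[OF assms(2), of q n] S_def mult.commute[of q]
      fps_rising_of_nat_mult)
  have "p ^ n * (1 - p) * fps_rising 1 = (fps_X * L * S) ^ n * (S * (fps_rising 1 + L))"
    by (simp only: mult.assoc compl) (simp add: p mult.assoc)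
  also have "\<dots> = fps_X ^ n * (fps_const (lam ^ n) * (fps_rising q ^ n * fps_rising 1 * S ^ Suc n +
      fps_const lam * (fps_rising q ^ n * fps_rising q * S ^ Suc n)))"
    by (simp add: L_def power_mult_distrib fps_const_power algebra_simps)
  finally show ?thesis
    by (simp only: shift)
qed

section \<open>Probabilities as coefficients of generating functions\<close>

lemma (in prob_space) prob_eq_sum_of_indep:
  fixes X Y :: "'a \<Rightarrow> nat"
  assumes "indep_var borel (\<lambda>\<omega>. real (X \<omega>)) borel (\<lambda>\<omega>. real (Y \<omega>))"
  shows "\<P>(\<omega> in M. X \<omega> + Y \<omega> = s) = (\<Sum>i=0..s. \<P>(\<omega> in M. X \<omega> = i) * \<P>(\<omega> in M. Y \<omega> = s - i))"
proof -
  have rv: "random_variable borel (\<lambda>\<omega>. real (X \<omega>))" "random_variable borel (\<lambda>\<omega>. real (Y \<omega>))"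
    using assms indep_var_rv1 indep_var_rv2 by blast+
  let ?E = "\<lambda>i. {\<omega> \<in> space M. X \<omega> = i \<and> Y \<omega> = s - i}"
  have meas: "{\<omega> \<in> space M. X \<omega> = i} \<in> events" "{\<omega> \<in> space M. Y \<omega> = i} \<in> events" for i
  proof -
    have "{\<omega> \<in> space M. real (X \<omega>) = real i} \<in> events" "{\<omega> \<in> space M. real (Y \<omega>) = real i} \<in> events"
      using rv by measurable
    then show "{\<omega> \<in> space M. X \<omega> = i} \<in> events" "{\<omega> \<in> space M. Y \<omega> = i} \<in> events"
      by simp_all
  qed
  have "?E i = {\<omega> \<in> space M. X \<omega> = i} \<inter> {\<omega> \<in> space M. Y \<omega> = s - i}" for i
    by auto
  then have E: "?E i \<in> events" for i
    using meas by auto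
  have "{\<omega> \<in> space M. X \<omega> + Y \<omega> = s} = (\<Union>i\<in>{0..s}. ?E i)"
    by auto
  then have "\<P>(\<omega> in M. X \<omega> + Y \<omega> = s) = (\<Sum>i=0..s. prob (?E i))"
    using E by (simp only:) (intro finite_measure_finite_Union, auto simp: disjoint_family_on_def)
  also have "\<dots> = (\<Sum>i=0..s. \<P>(\<omega> in M. X \<omega> = i) * \<P>(\<omega> in M. Y \<omega> = s - i))"
  proof (intro sum.cong refl)
    fix i
    have "(\<lambda>\<omega>. (real (X \<omega>), real (Y \<omega>))) -` ({real i} \<times> {real (s - i)}) \<inter> space M = ?E i"
      "(\<lambda>\<omega>. real (X \<omega>)) -` {real i} \<inter> space M = {\<omega> \<in> space M. X \<omega> = i}"
      "(\<lambda>\<omega>. real (Y \<omega>)) -` {real (s - i)} \<inter> space M = {\<omega> \<in> space M. Y \<omega> = s - i}"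
      by auto
    then show "prob (?E i) = \<P>(\<omega> in M. X \<omega> = i) * \<P>(\<omega> in M. Y \<omega> = s - i)"
      using indep_varD[OF assms, of "{real i}" "{real (s - i)}"] by simp
  qed
  finally show ?thesis .
qed

lemma (in prob_space) prob_arrival_time_eq:
  assumes indep: "indep_vars (\<lambda>_. count_space UNIV) T {1..}"
    and p: "\<And>i s. i \<ge> 1 \<Longrightarrow> \<P>(\<omega> in M. T i \<omega> = s) = fps_nth p s"
  shows "\<P>(\<omega> in M. arrival_time T n \<omega> = s) = fps_nth (p ^ n) s"
proof (induction n arbitrary: s)
  case 0
  then show ?case by (simp add: arrival_time_def prob_space)
next
  case (Suc n)
  \<comment> \<open>Passing to real values makes \<open>indep_vars_sum\<close> applicable: the last
    waiting time is independent of the sum of the earlier ones, and the convolution of their laws is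
    a Cauchy product.\<close>
  have "indep_vars (\<lambda>_. borel) (\<lambda>i \<omega>. real (T i \<omega>)) {1..}"
    using indep by (rule indep_vars_compose2) simp
  then have "indep_vars (\<lambda>_. borel) (\<lambda>i \<omega>. real (T i \<omega>)) (insert (Suc n) {1..n})"
    by (rule indep_vars_subset) auto
  then have "indep_var borel (\<lambda>\<omega>. real (T (Suc n) \<omega>)) borel (\<lambda>\<omega>. \<Sum>i=1..n. real (T i \<omega>))"
    by (intro indep_vars_sum) auto
  then have "indep_var borel (\<lambda>\<omega>. real (T (Suc n) \<omega>)) borel (\<lambda>\<omega>. real (arrival_time T n \<omega>))"
    by (simp add: arrival_time_def)
  from prob_eq_sum_of_indep[OF this, of s] show ?case
    using p[of "Suc n"] Suc
    by (simp add: arrival_time_def fps_mult_nth add.commute)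
qed

text \<open>Arrival times increase strictly, so those up to \<open>t\<close> form a finite initial
  segment of indices, whose maximum is the last index before the first failure.\<close>

lemma counting_process_eq_iff:
  assumes "\<And>i. i \<ge> 1 \<Longrightarrow> T i \<omega> \<ge> 1"
  shows "counting_process T t \<omega> = n \<longleftrightarrow> arrival_time T n \<omega> \<le> t \<and> \<not> arrival_time T (Suc n) \<omega> \<le> t"
proof -
  have step: "arrival_time T k \<omega> < arrival_time T (Suc k) \<omega>" for k
    using assms[of "Suc k"] by (simp add: arrival_time_def)
  then have mono: "strict_mono (\<lambda>k. arrival_time T k \<omega>)"
    by (simp add: strict_mono_Suc_iff)
  let ?A = "{k. arrival_time T k \<omega> \<le> t}"
  \<comment> \<open>A strictly increasing sequence of naturals satisfies S_k >= k.\<close>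
  have "?A \<subseteq> {..t}"
    using strict_mono_imp_increasing[OF mono] by (auto intro: order_trans)
  then have fin: "finite ?A"
    by (rule finite_subset) simp
  have ne: "0 \<in> ?A"
    by (simp add: arrival_time_def)
  show ?thesis
  proof
    assume eq: "counting_process T t \<omega> = n"
    have "n \<in> ?A"
      using Max_in[OF fin] ne eq by (auto simp: counting_process_def)
    moreover have "Suc n \<notin> ?A"
      using Max_ge[OF fin, of "Suc n"] eq by (auto simp: counting_process_def)
    ultimately show "arrival_time T n \<omega> \<le> t \<and> \<not> arrival_time T (Suc n) \<omega> \<le> t"
      by simp
  next
    assume *: "arrival_time T n \<omega> \<le> t \<and> \<not> arrival_time T (Suc n) \<omega> \<le> t"
    have "k \<le> n" if "arrival_time T k \<omega> \<le> t" for k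
    proof (rule ccontr)
      assume "\<not> k \<le> n"
      then have "arrival_time T (Suc n) \<omega> \<le> arrival_time T k \<omega>"
        using strict_mono_less_eq[OF mono, of "Suc n" k] by simp
      then show False
        using * that by simp
    qed
    then show "counting_process T t \<omega> = n"
      unfolding counting_process_def using * fin by (intro Max_eqI) auto
  qed
qed

lemma (in prob_space) prob_counting_process_eq:
  assumes indep: "indep_vars (\<lambda>_. count_space UNIV) T {1..}"
    and pos: "\<And>i \<omega>. i \<ge> 1 \<Longrightarrow> \<omega> \<in> space M \<Longrightarrow> T i \<omega> \<ge> 1"
    and p: "\<And>i s. i \<ge> 1 \<Longrightarrow> \<P>(\<omega> in M. T i \<omega> = s) = fps_nth p s"
  shows "\<P>(\<omega> in M. counting_process T t \<omega> = n) = fps_nth (p ^ n * (1 - p) * fps_rising 1) t"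
proof -
  have T: "T i \<in> measurable M (count_space UNIV)" if "i \<ge> 1" for i
    using indep that by (auto simp: indep_vars_def)
  have A: "arrival_time T k \<in> measurable M (count_space UNIV)" for k
  proof -
    have "(\<lambda>\<omega>. \<Sum>i=1..k. T i \<omega>) \<in> measurable M (count_space UNIV)"
      by (induction k) (use T in auto)
    then show ?thesis
      by (simp add: arrival_time_def[abs_def])
  qed
  let ?C = "\<lambda>k. {\<omega> \<in> space M. arrival_time T k \<omega> \<le> t}"
  have ev: "{\<omega> \<in> space M. Q (arrival_time T k \<omega>)} \<in> events" for k Q
    using A[of k] by measurable
  have cdf: "prob (?C k) = fps_nth (p ^ k * fps_rising 1) t" for k
  proof -
    have "?C k = (\<Union>s\<in>{0..t}. {\<omega> \<in> space M. arrival_time T k \<omega> = s})"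
      by auto
    then have "prob (?C k) = (\<Sum>s=0..t. \<P>(\<omega> in M. arrival_time T k \<omega> = s))"
      by (simp only:) (intro finite_measure_finite_Union, auto simp: disjoint_family_on_def intro: ev[of "\<lambda>j. j = _"])
    then show ?thesis
      using prob_arrival_time_eq[OF indep p] by (simp add: fps_mult_nth fps_rising_1)
  qed
  have "?C (Suc n) \<subseteq> ?C n"
    by (auto simp: arrival_time_def)
  moreover have "{\<omega> \<in> space M. counting_process T t \<omega> = n} = ?C n - ?C (Suc n)"
    using counting_process_eq_iff[of T _ t n] pos by auto
  ultimately have "\<P>(\<omega> in M. counting_process T t \<omega> = n) = prob (?C n) - prob (?C (Suc n))"
    using finite_measure_Diff ev by simp
  \<comment> \<open>The difference of the two distribution functions comes from p^n - p^(n+1) = p^n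
    (1 - p).\<close>
  also have "\<dots> = fps_nth (p ^ n * (1 - p) * fps_rising 1) t"
    by (simp add: cdf algebra_simps flip: fps_sub_nth)
  finally show ?thesis .
qed

text \<open>If Q generates the tail probabilities, then (1 - X) Q is 1 minus the probability
  generating function. Here Q = 1 + X S / (1 - X), which leaves 1 - X (1 - S).\<close>

lemma (in prob_space) prob_eq_of_tail_discrete_ML:
  fixes X :: "'a \<Rightarrow> nat"
  assumes X: "X \<in> measurable M (count_space UNIV)"
    and pos: "\<And>\<omega>. \<omega> \<in> space M \<Longrightarrow> X \<omega> \<ge> 1"
    and tail: "\<And>s. s \<ge> 1 \<Longrightarrow> \<P>(\<omega> in M. X \<omega> > s) = discrete_ML q (- lam) (real s)"
    and "0 \<le> q" "\<bar>lam\<bar> < 1"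
  shows "\<P>(\<omega> in M. X \<omega> = s) = fps_nth (fps_X * (1 - mittag_fps q lam 0 0)) s"
proof -
  define Q where "Q s = \<P>(\<omega> in M. X \<omega> > s)" for s
  define S where "S = mittag_fps q lam 0 0"
  have ev: "{\<omega> \<in> space M. R (X \<omega>)} \<in> events" for R
    using X by measurable
  \<comment> \<open>The tail formula is assumed only from 1 on; the value at 0 comes from
    positivity.\<close>
  have Q0: "Q 0 = 1"
  proof -
    have "{\<omega> \<in> space M. X \<omega> > 0} = space M"
      using pos by (auto simp: Suc_le_eq)
    then show ?thesis
      by (simp add: Q_def prob_space)
  qed
  have "Q (Suc k) = fps_nth (fps_rising 1 * S) k" for k
  proof -
    have "Q (Suc k) = (\<Sum>m. hhat (q * real m) (real k + 1) * (- lam) ^ m)"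
      using tail[of "Suc k"] by (simp add: Q_def discrete_ML_def add.commute)
    also have "\<dots> = fps_nth (mittag_fps q lam 0 (0 + 1)) k"
      using \<open>0 \<le> q\<close> by (simp add: mittag_fps_def hhat_Suc mult_nonneg_nonneg add_nonneg_pos mult.commute)
    finally show ?thesis
      using assms by (simp only: mittag_fps_add S_def)
  qed
  then have QS: "Abs_fps Q = 1 + fps_X * (fps_rising 1 * S)"
    using Q0 by (intro fps_ext) (auto simp: gr0_conv_Suc split: nat.splits)
  have "fps_nth ((1 - fps_X) * Abs_fps Q) s = (if s = 0 then 1 else Q s - Q (s - 1))"
    using Q0 by (cases s) (auto simp: left_diff_distrib)
  moreover have "\<P>(\<omega> in M. X \<omega> = s) = (if s = 0 then 0 else Q (s - 1) - Q s)"
  proof (cases s)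
    case 0
    have "{\<omega> \<in> space M. X \<omega> = 0} = {}"
      using pos by force
    then have "\<P>(\<omega> in M. X \<omega> = 0) = 0"
      by (simp only: measure_empty)
    then show ?thesis
      using 0 by simp
  next
    case (Suc k)
    have "{\<omega> \<in> space M. X \<omega> = s} = {\<omega> \<in> space M. X \<omega> > k} - {\<omega> \<in> space M. X \<omega> > s}"
      using Suc by auto
    moreover have "{\<omega> \<in> space M. X \<omega> > s} \<subseteq> {\<omega> \<in> space M. X \<omega> > k}"
      using Suc by auto
    ultimately show ?thesis
      using Suc finite_measure_Diff ev by (simp add: Q_def)
  qed
  moreover have "(1 - fps_X) * Abs_fps Q = 1 - fps_X * (1 - S)"
  proof -
    have "(1 - fps_X) * Abs_fps Q = (1 - fps_X) + fps_X * (((1 - fps_X) * fps_rising 1) * S)"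
      by (simp add: QS algebra_simps)
    then show ?thesis
      by (simp only: one_minus_X_mult_fps_rising_1) (simp add: algebra_simps)
  qed
  ultimately show ?thesis
    by (simp add: S_def split: if_splits)
qed

theorem theorem3:
  fixes M :: "'a measure" and T :: "nat \<Rightarrow> 'a \<Rightarrow> nat" and q lam :: real and n t :: nat
  assumes prob: "prob_space M"
    and lam: "0 < lam" "lam < 1"
    and q: "0 < q" "q \<le> 1"
    and indep: "prob_space.indep_vars M (\<lambda>_. count_space UNIV) T {1..}"
    and ident: "\<And>i j. i \<ge> 1 \<Longrightarrow> j \<ge> 1 \<Longrightarrow>
        distr M (count_space UNIV) (T i) = distr M (count_space UNIV) (T j)"
    and pos: "\<And>i \<omega>. i \<ge> 1 \<Longrightarrow> \<omega> \<in> space M \<Longrightarrow> T i \<omega> \<ge> 1"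
    and tail: "\<And>i s :: nat. i \<ge> 1 \<Longrightarrow> s \<ge> 1 \<Longrightarrow>
        \<P>(\<omega> in M. T i \<omega> > s) = discrete_ML q (- lam) (real s)"
    and nt: "n \<le> t"
  shows "summable (\<lambda>m. real ((n + m) choose n) * (- lam) ^ m *
            (hhat (q * real (n + m)) (real t - real n + 1) +
             lam * hhat (q * real (n + m + 1) - 1) (real t - real n + 1)))
    \<and> \<P>(\<omega> in M. counting_process T t \<omega> = n) =
        lam ^ n * (\<Sum>m. real ((n + m) choose n) * (- lam) ^ m *
            (hhat (q * real (n + m)) (real t - real n + 1) +
             lam * hhat (q * real (n + m + 1) - 1) (real t - real n + 1)))"
proof -
  interpret prob_space M by fact
  define p where "p = fps_X * (1 - mittag_fps q lam 0 0)"
  \<comment> \<open>The factor X^n moves coefficient \<open>t\<close> to \<open>t - n\<close>, and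
    \<open>hhat\<close> at \<open>t - n + 1\<close> is coefficient \<open>k\<close> of a binomial
    series.\<close>
  define k where "k = t - n"
  define u where "u c m = real ((n + m) choose n) * (- lam) ^ m *
    fps_nth (fps_rising (q * real m + c)) k" for c m
  let ?c = "q * real n + 1" and ?d = "q * real n + q"
  have "\<bar>lam\<bar> < 1"
    using lam by simp
  then have u: "summable (u c)" for c
    unfolding u_def by (rule summable_mittag_fps)
  have term_eq: "real ((n + m) choose n) * (- lam) ^ m *
      (hhat (q * real (n + m)) (real t - real n + 1) +
       lam * hhat (q * real (n + m + 1) - 1) (real t - real n + 1)) = u ?c m + lam * u ?d m" for m
  proof -
    have k: "real t - real n + 1 = real k + 1"
      using nt by (simp add: k_def of_nat_diff)
    have "hhat (q * real (n + m)) (real k + 1) = fps_nth (fps_rising (q * real m + ?c)) k"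
      using q by (subst hhat_Suc) (simp_all add: add_pos_nonneg algebra_simps)
    \<comment> \<open>This puts the index \<open>q * real (n + m + 1) - 1\<close> above -1, as
      \<open>hhat_Suc\<close> requires.\<close>
    moreover have "0 < q * real (n + m + 1)"
      using q by (intro mult_pos_pos) auto
    then have "hhat (q * real (n + m + 1) - 1) (real k + 1) = fps_nth (fps_rising (q * real m + ?d)) k"
      by (subst hhat_Suc) (simp_all add: algebra_simps)
    ultimately show ?thesis
      unfolding k u_def by (simp add: algebra_simps)
  qed
  have T: "T i \<in> measurable M (count_space UNIV)" if "i \<ge> 1" for i
    using indep that by (auto simp: indep_vars_def)
  have "\<P>(\<omega> in M. T i \<omega> = s) = fps_nth p s" if "i \<ge> 1" for i s
    unfolding p_def using that T pos tail q \<open>\<bar>lam\<bar> < 1\<close>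
    by (intro prob_eq_of_tail_discrete_ML) auto
  then have "\<P>(\<omega> in M. counting_process T t \<omega> = n) = fps_nth (p ^ n * (1 - p) * fps_rising 1) t"
    using prob_counting_process_eq[OF indep pos] by simp
  also have "\<dots> = lam ^ n * (suminf (u ?c) + lam * suminf (u ?d))"
    using nt unfolding p_def renewal_fps_identity[OF \<open>\<bar>lam\<bar> < 1\<close>]
    by (simp add: fps_X_power_mult_nth mittag_fps_def u_def[abs_def] k_def)
  also have "suminf (u ?c) + lam * suminf (u ?d) = (\<Sum>m. u ?c m + lam * u ?d m)"
    using u by (simp add: suminf_mult flip: suminf_add)
  finally show ?thesis
    unfolding term_eq using u by (auto intro!: summable_add summable_mult)
qed

end
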